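(* Assume the disturbance satisfies $\|\dot d(t)\|\le \xi_d$ for all $t\ge 0$. Let $C_1,C_2,\beta>0$, let $e_1=\hat F_1-\omega_e$, $e_2=\hat F_2-J^{-1}d$, and $\varepsilon=[\beta e_1^{T},e_2^{T}]^{T}\in\mathbb R^6$. Then there exist a symmetric positive definite matrix $Q_2\in\mathbb R^{6\times 6}$ and constants $C_d>0$, $h_m\ge 0$ such that $V_\varepsilon=\varepsilon^TQ_2\varepsilon$ satisfies $\dot V_\varepsilon\le -C_dV_\varepsilon+h_m$ along solutions. Consequently $\varepsilon$ converges exponentially into a compact set (it is uniformly ultimately bounded), and the disturbance estimation error $\tilde d=d-\hat d$ is bounded on $[0,\infty)$ and uniformly ultimately bounded, with ultimate bound of the form $\|\tilde d\|\le \lambda_{J\max}\sqrt{h_m/(\chi C_d\lambda_{Q\min})}$ for any $\chi\in(0,1)$, where $\lambda_{Q\min}$ is the smallest eigenvalue of $Q_2$.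
   Context: Attitude error dynamics: $\dot q_{ev}=F_e\omega_e$, $\dot q_{e0}=-\tfrac12 q_{ev}^T\omega_e$, $J\dot\omega_e=\Omega_e+u+d$, where $(q_{ev},q_{e0})\in\mathbb R^3\times\mathbb R$ is a unit quaternion, $\omega_e\in\mathbb R^3$, $F_e=\tfrac12(q_{e0}I_3+q_{ev}^\times)$ with $a^\times$ the skew-symmetric cross-product matrix of $a$, $J\in\mathbb R^{3\times3}$ is a known symmetric positive definite matrix with smallest/largest eigenvalues $\lambda_{J\min},\lambda_{J\max}$, $\Omega_e(t)\in\mathbb R^3$ is a known signal, $u(t)\in\mathbb R^3$ is the control input and $d(t)\in\mathbb R^3$ is an unknown bounded disturbance. Disturbance observer: with $F_d=J^{-1}\Omega_e$, the observer states $\hat F_1,\hat F_2\in\mathbb R^3$ evolve by $\dot{\hat F}_1=F_d+J^{-1}u+\hat F_2-C_1\beta e_1$, $\dot{\hat F}_2=-C_2\beta^2e_1$, where $e_1=\hat F_1-\omega_e$; the disturbance estimate is $\hat d=J\hat F_2$. *)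

theory Defs
  imports "HOL-Analysis.Analysis" "HOL-Library.Numeral_Type"
begin

text \<open>Skew-symmetric cross-product matrix: skew a *v b = a x b.\<close>
definition skew :: "real^3 \<Rightarrow> real^3^3" where
  "skew a = vector [vector [0, - a$3, a$2],
                    vector [a$3, 0, - a$1],
                    vector [- a$2, a$1, 0]]"

text \<open>F_e = 1/2 (q_e0 I_3 + q_ev^x).\<close>
definition Fe :: "real^3 \<Rightarrow> real \<Rightarrow> real^3^3" where
  "Fe qv q0 = (1/2) *\<^sub>R (q0 *\<^sub>R mat 1 + skew qv)"

definition sym_pos_def :: "real^'n^'n \<Rightarrow> bool" where
  "sym_pos_def A \<longleftrightarrow> transpose A = A \<and> (\<forall>x. x \<noteq> 0 \<longrightarrow> x \<bullet> (A *v x) > 0)"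

definition mat_eigenvalues :: "real^'n^'n \<Rightarrow> real set" where
  "mat_eigenvalues A = {l. \<exists>v. v \<noteq> 0 \<and> A *v v = l *\<^sub>R v}"

definition lambda_min :: "real^'n^'n \<Rightarrow> real" where
  "lambda_min A = Min (mat_eigenvalues A)"

definition lambda_max :: "real^'n^'n \<Rightarrow> real" where
  "lambda_max A = Max (mat_eigenvalues A)"

text \<open>Stacked error vector eps = [beta e1; e2] in R^6, indexed by 3 + 3.\<close>
definition stack :: "real \<Rightarrow> real^3 \<Rightarrow> real^3 \<Rightarrow> real^(3+3)" where
  "stack \<beta> e1 e2 = (\<chi> i. case i of Inl k \<Rightarrow> \<beta> * e1 $ k | Inr k \<Rightarrow> e2 $ k)"

end

theory Submission
  imports Defs "HOL-Real_Asymp.Real_Asymp" "HOL-Computational_Algebra.Polynomial"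
begin

text \<open>With \<open>e1 = \<beta> (F1 - w)\<close> and \<open>e2 = F2 - J\<^sup>-\<^sup>1 d\<close> the observer errors obey
  \<open>e1' = \<beta> (e2 - C1 e1)\<close> and \<open>e2' = - C2 \<beta> e1 - J\<^sup>-\<^sup>1 d'\<close>. For suitable gains \<open>p, q\<close> the form
  \<open>V = p \<parallel>e1\<parallel>\<^sup>2 - 2 e1 \<bullet> e2 + q \<parallel>e2\<parallel>\<^sup>2\<close> is positive definite, and the cross terms of \<open>V'\<close> cancel, so
  Young's inequality and the bound on \<open>d'\<close> give \<open>V' \<le> - Cd V + h\<close>. Comparison with the linear
  equation makes \<open>V\<close> converge exponentially into a ball, and \<open>d - J F2 = - J e2\<close> is controlled
  by \<open>V\<close>.\<close>

section \<open>Eigenvalues\<close>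

lemma mat_matrix_vector_mult: "(mat l :: real^'n^'n) *v v = l *\<^sub>R v"
  by (simp add: vec_eq_iff matrix_vector_mult_def mat_def if_distrib[where f="\<lambda>z. _ * z"]
      mult.commute cong: if_cong)

lemma inj_matrix_vector_mult_iff_det: "inj ((*v) (A::real^'n^'n)) \<longleftrightarrow> det A \<noteq> 0"
  by (simp add: invertible_det_nz[symmetric] invertible_left_inverse matrix_left_invertible_injective)

lemma mem_mat_eigenvalues_iff_det: "l \<in> mat_eigenvalues (A::real^'n^'n) \<longleftrightarrow> det (A - mat l) = 0"
proof -
  have "l \<in> mat_eigenvalues A \<longleftrightarrow> \<not> inj ((*v) (A - mat l))"
  proof
    assume "l \<in> mat_eigenvalues A"
    then obtain v where "v \<noteq> 0" "A *v v = l *\<^sub>R v" by (auto simp: mat_eigenvalues_def)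
    then have "(A - mat l) *v v = (A - mat l) *v 0"
      by (simp add: matrix_vector_mult_diff_rdistrib mat_matrix_vector_mult)
    then show "\<not> inj ((*v) (A - mat l))" using \<open>v \<noteq> 0\<close> unfolding inj_def by blast
  next
    assume "\<not> inj ((*v) (A - mat l))"
    then obtain x y where "x \<noteq> y" "(A - mat l) *v x = (A - mat l) *v y" unfolding inj_def by blast
    then have "x - y \<noteq> 0" "A *v (x - y) = l *\<^sub>R (x - y)"
      by (simp_all add: matrix_vector_mult_diff_rdistrib mat_matrix_vector_mult
          matrix_vector_mult_diff_distrib algebra_simps)
    then show "l \<in> mat_eigenvalues A" unfolding mat_eigenvalues_def by blast
  qed
  also have "\<dots> \<longleftrightarrow> det (A - mat l) = 0"
    by (simp add: inj_matrix_vector_mult_iff_det)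
  finally show ?thesis .
qed

definition charpoly_3 :: "real^3^3 \<Rightarrow> real poly" where
  "charpoly_3 A = [:det A, -(A$1$1*A$2$2 + A$1$1*A$3$3 + A$2$2*A$3$3
                             - A$1$2*A$2$1 - A$1$3*A$3$1 - A$2$3*A$3$2),
                   A$1$1 + A$2$2 + A$3$3, -1:]"

lemma det_minus_mat_3: "det (A - mat l) = poly (charpoly_3 A) l"
  by (simp add: charpoly_3_def det_3 mat_def algebra_simps)

lemma finite_mat_eigenvalues_3: "finite (mat_eigenvalues (A::real^3^3))"
proof -
  have "finite {x. poly (charpoly_3 A) x = 0}"
    by (rule poly_roots_finite) (simp add: charpoly_3_def)
  then show ?thesis
    by (rule rev_finite_subset) (auto simp: mem_mat_eigenvalues_iff_det det_minus_mat_3)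
qed

lemma cubic_has_real_root: "\<exists>x::real. c + b*x + a*x^2 - x^3 = 0"
proof -
  have "filterlim (\<lambda>l. c + b*l + a*l^2 - l^3) at_bot at_top" by real_asymp
  then obtain L1 where L1: "\<And>l. l \<ge> L1 \<Longrightarrow> c + b*l + a*l^2 - l^3 < 0"
    unfolding filterlim_at_bot_dense eventually_at_top_linorder by blast
  have "filterlim (\<lambda>l. c + b*l + a*l^2 - l^3) at_top at_bot" by real_asymp
  then obtain L2 where L2: "\<And>l. l \<le> L2 \<Longrightarrow> c + b*l + a*l^2 - l^3 > 0"
    unfolding filterlim_at_top_dense eventually_at_bot_linorder by blast
  have "\<exists>x\<ge>min L1 L2. x \<le> max L1 L2 \<and> c + b*x + a*x^2 - x^3 = 0"
    using L1[of "max L1 L2"] L2[of "min L1 L2"]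
    by (intro IVT2') (auto intro!: continuous_intros less_imp_le)
  then show ?thesis by blast
qed

lemma mat_eigenvalues_3_nonempty: "mat_eigenvalues (A::real^3^3) \<noteq> {}"
proof -
  let ?c = "\<lambda>i. coeff (charpoly_3 A) i"
  have "det (A - mat l) = ?c 0 + ?c 1 * l + ?c 2 * l^2 - l^3" for l
    by (simp add: det_minus_mat_3 charpoly_3_def eval_nat_numeral algebra_simps)
  then show ?thesis
    using cubic_has_real_root[of "?c 0" "?c 1" "?c 2"] by (auto simp: mem_mat_eigenvalues_iff_det)
qed

lemma mat_eigenvalues_pos: "sym_pos_def A \<Longrightarrow> l \<in> mat_eigenvalues A \<Longrightarrow> l > 0"
proof -
  assume A: "sym_pos_def A" and "l \<in> mat_eigenvalues A"
  then obtain v where v: "v \<noteq> 0" "A *v v = l *\<^sub>R v" by (auto simp: mat_eigenvalues_def)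
  then have "l * (v \<bullet> v) > 0" using A by (auto simp: sym_pos_def_def)
  then show ?thesis using inner_ge_zero[of v] by (auto simp: zero_less_mult_iff)
qed

lemma lambda_max_3_pos: "sym_pos_def (A::real^3^3) \<Longrightarrow> lambda_max A > 0"
  unfolding lambda_max_def
  by (rule mat_eigenvalues_pos, assumption,
      rule Max_in[OF finite_mat_eigenvalues_3 mat_eigenvalues_3_nonempty])

lemma sym_pos_def_invertible: "sym_pos_def (A::real^'n^'n) \<Longrightarrow> invertible A"
proof -
  assume A: "sym_pos_def A"
  have "inj ((*v) A)"
  proof (rule injI)
    fix x y assume "A *v x = A *v y"
    then have "(x - y) \<bullet> (A *v (x - y)) = 0" by (simp add: matrix_vector_mult_diff_distrib)
    then show "x = y" using A unfolding sym_pos_def_def by (metis eq_iff_diff_eq_0 less_irrefl)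
  qed
  then show ?thesis by (simp add: inj_matrix_vector_mult_iff_det invertible_det_nz)
qed

lemma matrix_inv_cancel:
  assumes "invertible (A::real^'n^'n)"
  shows "A *v (matrix_inv A *v x) = x" "matrix_inv A *v (A *v x) = x"
proof -
  have "A ** matrix_inv A = mat 1 \<and> matrix_inv A ** A = mat 1"
    using assms unfolding invertible_def matrix_inv_def by (rule someI_ex)
  then show "A *v (matrix_inv A *v x) = x" "matrix_inv A *v (A *v x) = x"
    by (simp_all add: matrix_vector_mul_assoc)
qed

section \<open>Block matrices with scalar blocks\<close>

definition block_vec :: "real^'a::finite \<Rightarrow> real^'b::finite \<Rightarrow> real^('a+'b)" where
  "block_vec x y = (\<chi> i. case i of Inl k \<Rightarrow> x $ k | Inr k \<Rightarrow> y $ k)"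

text \<open>The block matrix \<open>[p I, r I; r I, q I]\<close>.\<close>
definition block_mat :: "real \<Rightarrow> real \<Rightarrow> real \<Rightarrow> real^('a::finite+'a)^('a+'a)" where
  "block_mat p r q = (\<chi> i j. case i of
      Inl a \<Rightarrow> (case j of Inl b \<Rightarrow> if a = b then p else 0 | Inr b \<Rightarrow> if a = b then r else 0)
    | Inr a \<Rightarrow> (case j of Inl b \<Rightarrow> if a = b then r else 0 | Inr b \<Rightarrow> if a = b then q else 0))"

lemma block_vec_nth [simp]:
  "block_vec x y $ Inl i = x $ i" "block_vec x y $ Inr j = y $ j"
  by (simp_all add: block_vec_def)

lemma stack_eq_block_vec: "stack \<beta> x y = block_vec (\<beta> *\<^sub>R x) y"
  by (simp add: stack_def block_vec_def vec_eq_iff split: sum.split)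

lemma block_vec_components: "z = block_vec (\<chi> k. z $ Inl k) (\<chi> k. z $ Inr k)"
  by (simp add: vec_eq_iff block_vec_def split: sum.split)

lemma block_vec_eq_iff: "block_vec x y = block_vec a b \<longleftrightarrow> x = a \<and> y = b"
  by (auto simp: vec_eq_iff block_vec_def split: sum.split)

lemma block_vec_eq_0_iff: "block_vec x y = 0 \<longleftrightarrow> x = 0 \<and> y = 0"
  by (auto simp: vec_eq_iff block_vec_def split: sum.split)

lemma scaleR_block_vec: "l *\<^sub>R block_vec x y = block_vec (l *\<^sub>R x) (l *\<^sub>R y)"
  by (simp add: vec_eq_iff block_vec_def split: sum.split)

lemma sum_UNIV_Plus: "sum g (UNIV :: ('a::finite + 'b::finite) set) = (\<Sum>k\<in>UNIV. g (Inl k)) + (\<Sum>k\<in>UNIV. g (Inr k))"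
  using sum.Plus[of UNIV UNIV g] by (simp add: comp_def)

lemma inner_block_vec: "block_vec a b \<bullet> block_vec c d = a \<bullet> c + b \<bullet> d"
  by (simp add: inner_vec_def sum_UNIV_Plus)

lemma block_mat_mult_block_vec:
  "block_mat p r q *v block_vec x y = block_vec (p *\<^sub>R x + r *\<^sub>R y) (r *\<^sub>R x + q *\<^sub>R y)"
  unfolding vec_eq_iff
proof
  fix i
  show "(block_mat p r q *v block_vec x y) $ i = block_vec (p *\<^sub>R x + r *\<^sub>R y) (r *\<^sub>R x + q *\<^sub>R y) $ i"
    by (cases i) (simp_all add: matrix_vector_mult_def block_mat_def sum_UNIV_Plus
        if_distrib[where f="\<lambda>z. _ * z"] mult.commute cong: if_cong)
qed

lemma transpose_block_mat: "transpose (block_mat p r q) = block_mat p r q"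
  by (auto simp: vec_eq_iff transpose_def block_mat_def split: sum.split)

lemma block_mat_quadratic_form:
  "block_vec x y \<bullet> (block_mat p r q *v block_vec x y) = p * (x \<bullet> x) + 2 * r * (x \<bullet> y) + q * (y \<bullet> y)"
  by (simp add: block_mat_mult_block_vec inner_block_vec inner_add_right inner_commute algebra_simps)

lemma block_mat_quadratic_form_ge:
  fixes x y :: "real^'a::finite"
  assumes "p > 0" "q > 0" "p * q \<ge> 4"
  shows "block_vec x y \<bullet> (block_mat p (-1) q *v block_vec x y) \<ge> min p q / 2 * (x \<bullet> x + y \<bullet> y)"
proof -
  have "2 / p \<le> q / 2" using assms by (simp add: field_simps)
  then have qy: "2 / p * norm y ^ 2 \<le> q / 2 * norm y ^ 2" by (rule mult_right_mono) simp
  have "2 * (x \<bullet> y) \<le> 2 * (norm x * norm y)" by (simp add: norm_cauchy_schwarz)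
  also have "\<dots> \<le> p / 2 * norm x ^ 2 + 2 / p * norm y ^ 2"
    using assms(1) sum_squares_ge_zero[of "p * norm x - 2 * norm y" 0]
    by (simp add: field_simps power2_eq_square)
  also have "\<dots> \<le> p / 2 * norm x ^ 2 + q / 2 * norm y ^ 2" using qy by simp
  finally have "2 * (x \<bullet> y) \<le> p / 2 * (x \<bullet> x) + q / 2 * (y \<bullet> y)"
    by (simp add: power2_norm_eq_inner)
  moreover have "min p q / 2 * (x \<bullet> x) \<le> p / 2 * (x \<bullet> x)" "min p q / 2 * (y \<bullet> y) \<le> q / 2 * (y \<bullet> y)"
    by (simp_all add: mult_right_mono)
  ultimately show ?thesis unfolding block_mat_quadratic_form distrib_left by linarith
qed

lemma block_mat_quadratic_form_le:
  fixes x y :: "real^'a::finite"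
  assumes "p > 0" "q > 0"
  shows "block_vec x y \<bullet> (block_mat p (-1) q *v block_vec x y) \<le> (p + q + 2) * (x \<bullet> x + y \<bullet> y)"
proof -
  have "- 2 * (x \<bullet> y) \<le> x \<bullet> x + y \<bullet> y"
    using inner_ge_zero[of "x + y"] by (simp add: inner_add_left inner_add_right inner_commute)
  moreover have "0 \<le> q * (x \<bullet> x)" "0 \<le> p * (y \<bullet> y)" using assms by simp_all
  ultimately show ?thesis
    using inner_ge_zero[of x] inner_ge_zero[of y]
    unfolding block_mat_quadratic_form distrib_left distrib_right by linarith
qed

lemma sym_pos_def_block_mat:
  assumes "p > 0" "q > 0" "p * q \<ge> 4"
  shows "sym_pos_def (block_mat p (-1) q :: real^('a::finite+'a)^('a+'a))"
  unfolding sym_pos_def_def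
proof (intro conjI allI impI transpose_block_mat)
  fix z :: "real^('a+'a)" assume "z \<noteq> 0"
  obtain x y where z: "z = block_vec x y" using block_vec_components by blast
  then have "x \<noteq> 0 \<or> y \<noteq> 0" using \<open>z \<noteq> 0\<close> block_vec_eq_0_iff by blast
  then have "x \<bullet> x + y \<bullet> y > 0" by (auto intro: add_pos_nonneg add_nonneg_pos)
  then have "min p q / 2 * (x \<bullet> x + y \<bullet> y) > 0" using assms by simp
  then show "z \<bullet> (block_mat p (-1) q *v z) > 0"
    using block_mat_quadratic_form_ge[OF assms, of x y] unfolding z by linarith
qed

lemma block_mat_eigenvalue:
  assumes "l \<in> mat_eigenvalues (block_mat p (-1) q :: real^('a::finite+'a)^('a+'a))"
  shows "(q - l) * (p - l) = 1"
proof -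
  obtain z :: "real^('a+'a)" where z: "z \<noteq> 0" "block_mat p (-1) q *v z = l *\<^sub>R z"
    using assms by (auto simp: mat_eigenvalues_def)
  obtain x y where xy: "z = block_vec x y" using block_vec_components by blast
  then have "x \<noteq> 0 \<or> y \<noteq> 0" using z block_vec_eq_0_iff by blast
  from z(2) have "y = (p - l) *\<^sub>R x" "x = (q - l) *\<^sub>R y"
    unfolding xy block_mat_mult_block_vec scaleR_block_vec block_vec_eq_iff by (auto simp: algebra_simps)
  then have "x = ((q - l) * (p - l)) *\<^sub>R x" "y = ((q - l) * (p - l)) *\<^sub>R y"
    by (metis scaleR_scaleR mult.commute)+
  then show ?thesis
    using \<open>x \<noteq> 0 \<or> y \<noteq> 0\<close> by (metis scaleR_cancel_right scaleR_one)
qed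

lemma lambda_min_block_mat_pos:
  assumes p: "p > 0" and q: "q > 0" and pq: "p * q \<ge> 4"
  shows "lambda_min (block_mat p (-1) q :: real^('a::finite+'a)^('a+'a)) > 0"
proof -
  let ?Q = "block_mat p (-1) q :: real^('a+'a)^('a+'a)"
  have "finite {l. poly [:p*q - 1, -(p+q), 1:] l = 0}" by (intro poly_roots_finite) simp
  then have fin: "finite (mat_eigenvalues ?Q)"
    by (rule rev_finite_subset) (auto dest: block_mat_eigenvalue simp: algebra_simps)
  define s where "s = sqrt ((p - q)^2 + 4)"
  define \<mu> where "\<mu> = (p + q - s) / 2"
  have "s^2 = (p - q)^2 + 4" unfolding s_def by simp
  then have \<mu>: "(\<mu> - p) * (\<mu> - q) = 1"
    unfolding \<mu>_def by (simp add: field_simps power2_eq_square)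
  fix a :: 'a
  define e :: "real^'a" where "e = axis a 1"
  have c: "- 1 + q * (p - \<mu>) = \<mu> * (p - \<mu>)" using \<mu> by (simp add: algebra_simps)
  have "(- 1) *\<^sub>R e + q *\<^sub>R ((p - \<mu>) *\<^sub>R e) = (- 1 + q * (p - \<mu>)) *\<^sub>R e"
    by (simp add: algebra_simps)
  also have "\<dots> = \<mu> *\<^sub>R ((p - \<mu>) *\<^sub>R e)" unfolding c by simp
  finally have "?Q *v block_vec e ((p - \<mu>) *\<^sub>R e) = \<mu> *\<^sub>R block_vec e ((p - \<mu>) *\<^sub>R e)"
    by (simp add: block_mat_mult_block_vec scaleR_block_vec block_vec_eq_iff algebra_simps)
  moreover have "block_vec e ((p - \<mu>) *\<^sub>R e) \<noteq> 0" by (simp add: block_vec_eq_0_iff e_def)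
  ultimately have "\<mu> \<in> mat_eigenvalues ?Q" unfolding mat_eigenvalues_def by blast
  then have "lambda_min ?Q \<in> mat_eigenvalues ?Q"
    unfolding lambda_min_def using fin by (intro Min_in) auto
  then show ?thesis by (rule mat_eigenvalues_pos[OF sym_pos_def_block_mat[OF p q pq]])
qed

section \<open>A linear differential inequality\<close>

lemma differential_inequality_exp_bound:
  fixes V :: "real \<Rightarrow> real"
  assumes "c > 0"
    and V': "\<And>t. t \<ge> 0 \<Longrightarrow> \<exists>V'. (V has_real_derivative V') (at t within {0..}) \<and> V' \<le> - c * V t + h"
    and "t \<ge> 0"
  shows "V t \<le> V 0 * exp (- c * t) + h / c * (1 - exp (- c * t))"
proof -
  define W where "W s = (V s - h / c) * exp (c * s)" for s
  have W': "\<exists>W'. (W has_real_derivative W') (at s within {0..}) \<and> W' \<le> 0" if s: "s \<ge> 0" for s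
  proof -
    obtain V' where "(V has_real_derivative V') (at s within {0..})" "V' \<le> - c * V s + h"
      using V' s by blast
    moreover from this(1) have "(W has_real_derivative (V' + c * V s - h) * exp (c * s)) (at s within {0..})"
      unfolding W_def using \<open>c > 0\<close>
      by (auto intro!: derivative_eq_intros simp: field_simps)
    ultimately show ?thesis by (intro exI conjI) (auto simp: mult_nonpos_nonneg)
  qed
  have "W t \<le> W 0"
  proof (rule DERIV_nonpos_imp_decreasing_open[OF \<open>t \<ge> 0\<close>])
    fix x assume "0 < x" "x < t"
    then have "at x within {0..} = at x" by (intro at_within_interior) simp
    then show "\<exists>y. DERIV W x :> y \<and> y \<le> 0" using W'[of x] \<open>0 < x\<close> by auto
  next
    show "continuous_on {0..t} W"
      unfolding continuous_on_eq_continuous_within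
    proof
      fix x assume "x \<in> {0..t}"
      then obtain y where "(W has_real_derivative y) (at x within {0..})" using W' by auto
      then have "continuous (at x within {0..}) W" by (rule DERIV_continuous)
      then show "continuous (at x within {0..t}) W" by (rule continuous_within_subset) auto
    qed
  qed
  then have "(V t - h / c) * exp (c * t) * exp (- c * t) \<le> (V 0 - h / c) * exp (- c * t)"
    by (simp add: W_def mult_right_mono)
  then show ?thesis by (simp add: mult.assoc flip: exp_add) (simp add: algebra_simps diff_divide_distrib)
qed

lemma exp_bound_eventually_le:
  fixes V :: "real \<Rightarrow> real"
  assumes "c > 0" "h > 0" "0 < \<rho>" "\<rho> < 1"
    and V: "\<And>t. t \<ge> 0 \<Longrightarrow> V t \<le> V 0 * exp (- c * t) + h / c * (1 - exp (- c * t))"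
  shows "\<exists>T\<ge>0. \<forall>t\<ge>T. V t \<le> h / (\<rho> * c)"
proof -
  have "((\<lambda>t. V 0 * exp (- c * t)) \<longlongrightarrow> 0) at_top"
    using \<open>c > 0\<close> by real_asymp
  moreover have "0 < h / (\<rho> * c) - h / c" using assms by (simp add: field_simps)
  ultimately have "eventually (\<lambda>t. V 0 * exp (- c * t) < h / (\<rho> * c) - h / c) at_top"
    by (rule order_tendstoD(2))
  then obtain T where T: "\<And>t. t \<ge> T \<Longrightarrow> V 0 * exp (- c * t) < h / (\<rho> * c) - h / c"
    by (auto simp: eventually_at_top_linorder)
  have "V t \<le> h / (\<rho> * c)" if "t \<ge> max T 0" for t
  proof -
    have "V t \<le> V 0 * exp (- c * t) + h / c * (1 - exp (- c * t))" using V that by simp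
    also have "\<dots> \<le> V 0 * exp (- c * t) + h / c" using assms by (simp add: field_simps)
    also have "\<dots> \<le> h / (\<rho> * c)" using T[of t] that by simp
    finally show ?thesis .
  qed
  then show ?thesis by (intro exI[of _ "max T 0"]) auto
qed

section \<open>The Lyapunov estimate\<close>

lemma has_real_derivative_inner:
  assumes "(f has_vector_derivative f') (at t within S)" "(g has_vector_derivative g') (at t within S)"
  shows "((\<lambda>x. f x \<bullet> g x) has_real_derivative (f t \<bullet> g' + f' \<bullet> g t)) (at t within S)"
  unfolding has_real_derivative_iff_has_vector_derivative
  by (rule bounded_bilinear.has_vector_derivative[OF bounded_bilinear_inner assms])

lemma two_mult_le_weighted_squares:
  fixes x y :: real assumes "s > 0" shows "2 * x * y \<le> s * x^2 + y^2 / s"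
proof -
  have "0 \<le> (s * x - y)^2 / s" using assms by simp
  also have "\<dots> = s * x^2 + y^2 / s - 2 * x * y" using assms by (simp add: power2_eq_square field_simps)
  finally show ?thesis by simp
qed

text \<open>The relation \<open>q C2 = p + C1\<close> cancels the cross terms \<open>e1 \<bullet> e2\<close>; the disturbance terms
  are absorbed by Young's inequality, at the price of half of the negative definite part.\<close>
lemma observer_lyapunov_derivative_le:
  fixes e1 e2 g :: "'a::real_inner"
  assumes "\<beta> > 0" "k1 > 0" "k1 = p * C1 - C2" "q * C2 = p + C1" "q > 0" "norm g \<le> G"
  shows "2 * p * (e1 \<bullet> (\<beta> *\<^sub>R (e2 - C1 *\<^sub>R e1)))
           - 2 * (e1 \<bullet> (- (C2 * \<beta>) *\<^sub>R e1 - g) + (\<beta> *\<^sub>R (e2 - C1 *\<^sub>R e1)) \<bullet> e2)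
           + 2 * q * (e2 \<bullet> (- (C2 * \<beta>) *\<^sub>R e1 - g))
         \<le> - \<beta> * k1 * (e1 \<bullet> e1) - \<beta> * (e2 \<bullet> e2) + (1 / (\<beta> * k1) + q^2 / \<beta>) * G^2"
    (is "?lhs \<le> _")
proof -
  have "?lhs = - 2 * \<beta> * (p * C1 - C2) * (e1 \<bullet> e1) - 2 * \<beta> * (e2 \<bullet> e2)
          + 2 * \<beta> * (p + C1 - q * C2) * (e1 \<bullet> e2) + 2 * (e1 \<bullet> g) - 2 * q * (e2 \<bullet> g)"
    by (simp add: inner_diff_right inner_diff_left inner_commute algebra_simps)
  also have "\<dots> = - 2 * \<beta> * k1 * (e1 \<bullet> e1) - 2 * \<beta> * (e2 \<bullet> e2) + 2 * (e1 \<bullet> g) - 2 * q * (e2 \<bullet> g)"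
    using assms(3,4) by simp
  finally have dV: "?lhs = \<dots>" .
  have G2: "norm g ^ 2 \<le> G ^ 2" using assms(6) by (intro power_mono) simp_all
  have "2 * (e1 \<bullet> g) \<le> 2 * norm e1 * norm g" using norm_cauchy_schwarz[of e1 g] by simp
  also have "\<dots> \<le> \<beta> * k1 * norm e1 ^ 2 + norm g ^ 2 / (\<beta> * k1)"
    using assms by (intro two_mult_le_weighted_squares) simp
  also have "\<dots> \<le> \<beta> * k1 * norm e1 ^ 2 + G ^ 2 / (\<beta> * k1)"
    using G2 assms by (simp add: divide_right_mono)
  finally have e1g: "2 * (e1 \<bullet> g) \<le> \<beta> * k1 * (e1 \<bullet> e1) + G^2 / (\<beta> * k1)"
    by (simp add: power2_norm_eq_inner)
  have "2 * q * (e2 \<bullet> - g) \<le> 2 * q * (norm e2 * norm (- g))"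
    using norm_cauchy_schwarz[of e2 "- g"] assms(5) by (intro mult_left_mono) simp_all
  then have "- 2 * q * (e2 \<bullet> g) \<le> 2 * norm e2 * (q * norm g)" by (simp add: algebra_simps)
  also have "\<dots> \<le> \<beta> * norm e2 ^ 2 + q^2 * norm g ^ 2 / \<beta>"
    using two_mult_le_weighted_squares[of \<beta> "norm e2" "q * norm g"] assms(1)
    by (simp add: power_mult_distrib)
  also have "\<dots> \<le> \<beta> * norm e2 ^ 2 + q^2 * G ^ 2 / \<beta>"
    using G2 assms by (simp add: divide_right_mono mult_left_mono)
  finally have e2g: "- 2 * q * (e2 \<bullet> g) \<le> \<beta> * (e2 \<bullet> e2) + q^2 * G^2 / \<beta>"
    by (simp add: power2_norm_eq_inner)
  have "(1 / (\<beta> * k1) + q^2 / \<beta>) * G^2 = G^2 / (\<beta> * k1) + q^2 * G^2 / \<beta>"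
    by (simp add: algebra_simps)
  then show ?thesis using dV e1g e2g by linarith
qed

section \<open>Observer gains\<close>

locale disturbance_observer =
  fixes J :: "real^3^3" and C1 C2 \<beta> \<xi>d :: real
  assumes J_spd: "sym_pos_def J" and C1_pos: "C1 > 0" and C2_pos: "C2 > 0" and beta_pos: "\<beta> > 0"
begin

text \<open>\<open>p\<close> is large enough for \<open>k1 = p C1 - C2 > 0\<close> and \<open>p q \<ge> 4\<close>; \<open>q\<close> is tied to \<open>p\<close> by
  \<open>q C2 = p + C1\<close>.\<close>
definition p :: real where "p = 2 * C2 / C1 + 2 * C2 + 2"
definition q :: real where "q = (p + C1) / C2"
definition k1 :: real where "k1 = p * C1 - C2"
definition Q2 :: "real^(3+3)^(3+3)" where "Q2 = block_mat p (-1) q"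
definition Cd :: real where "Cd = \<beta> * min k1 1 / (p + q + 2)"

text \<open>\<open>h0\<close> bounds the forcing term of the Lyapunov inequality (the summand 1 only makes it positive).
  Since only the operator norm of \<open>J\<close>, not \<open>\<lambda>max J\<close>, is compared with \<open>\<parallel>J e2\<parallel>\<close>, the ratio
  of the two is absorbed into \<open>hm \<ge> h0\<close>.\<close>
definition h0 :: real where
  "h0 = (1 / (\<beta> * k1) + q^2 / \<beta>) * (onorm ((*v) (matrix_inv J)) * \<bar>\<xi>d\<bar>)^2 + 1"
definition hm :: real where
  "hm = h0 * max 1 (onorm ((*v) J)^2 * lambda_min Q2 / (min p q / 2 * lambda_max J^2))"

lemma p_pos: "p > 0"
  unfolding p_def using C1_pos C2_pos by (simp add: add_pos_pos)

lemma q_pos: "q > 0"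
  unfolding q_def using p_pos C1_pos C2_pos by simp

lemma q_C2: "q * C2 = p + C1"
  unfolding q_def using C2_pos by simp

lemma k1_pos: "k1 > 0"
proof -
  have "k1 = C2 + (2 * C2 + 2) * C1" unfolding k1_def p_def using C1_pos by (simp add: field_simps)
  moreover have "(2 * C2 + 2) * C1 > 0" using C1_pos C2_pos by simp
  ultimately show ?thesis using C2_pos by linarith
qed

lemma p_q_ge_4: "p * q \<ge> 4"
proof -
  have p: "p \<ge> 2 * C2 + 2" unfolding p_def using C1_pos C2_pos by simp
  then have "2 * C2 \<le> q * C2" using q_C2 C1_pos by simp
  then have "2 \<le> q" using C2_pos by simp
  then show ?thesis using mult_mono[of 2 p 2 q] p C2_pos by simp
qed

lemma Q2_spd: "sym_pos_def Q2"
  unfolding Q2_def by (rule sym_pos_def_block_mat[OF p_pos q_pos p_q_ge_4])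

lemma lambda_min_Q2_pos: "lambda_min Q2 > 0"
  unfolding Q2_def by (rule lambda_min_block_mat_pos[OF p_pos q_pos p_q_ge_4])

lemma Cd_pos: "Cd > 0"
  unfolding Cd_def using beta_pos k1_pos p_pos q_pos by simp

lemma h0_pos: "h0 > 0"
  unfolding h0_def using beta_pos k1_pos by (simp add: add_nonneg_pos)

lemma hm_ge_h0: "hm \<ge> h0"
  unfolding hm_def using h0_pos by simp

lemma hm_pos: "hm > 0"
  using hm_ge_h0 h0_pos by linarith

lemma hm_absorbs_operator_norm:
  "onorm ((*v) J)^2 * (h0 / (min p q / 2)) \<le> lambda_max J^2 * (hm / lambda_min Q2)"
proof -
  have m: "min p q / 2 > 0" using p_pos q_pos by simp
  have L: "lambda_max J^2 > 0" using lambda_max_3_pos[OF J_spd] by simp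
  have "h0 * (onorm ((*v) J)^2 * lambda_min Q2 / (min p q / 2 * lambda_max J^2)) \<le> hm"
    unfolding hm_def using h0_pos by (intro mult_left_mono) simp_all
  then show ?thesis
    using m L lambda_min_Q2_pos by (simp add: field_simps)
qed

lemma J_invertible: "invertible J"
  by (rule sym_pos_def_invertible[OF J_spd])

end

section \<open>Error dynamics along a trajectory\<close>

locale disturbance_observer_trajectory = disturbance_observer +
  fixes w wd Om u d dd F1 F2 :: "real \<Rightarrow> real^3"
  assumes w_has_derivative: "\<And>t. t \<ge> 0 \<Longrightarrow> (w has_vector_derivative wd t) (at t within {0..})"
    and rigid_body_dynamics: "\<And>t. t \<ge> 0 \<Longrightarrow> J *v wd t = Om t + u t + d t"
    and d_has_derivative: "\<And>t. t \<ge> 0 \<Longrightarrow> (d has_vector_derivative dd t) (at t within {0..})"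
    and dd_bound: "\<And>t. t \<ge> 0 \<Longrightarrow> norm (dd t) \<le> \<xi>d"
    and F1_has_derivative: "\<And>t. t \<ge> 0 \<Longrightarrow> (F1 has_vector_derivative
          (matrix_inv J *v Om t + matrix_inv J *v u t + F2 t - (C1 * \<beta>) *\<^sub>R (F1 t - w t)))
          (at t within {0..})"
    and F2_has_derivative: "\<And>t. t \<ge> 0 \<Longrightarrow>
          (F2 has_vector_derivative (- (C2 * \<beta>^2) *\<^sub>R (F1 t - w t))) (at t within {0..})"
begin

definition e1 :: "real \<Rightarrow> real^3" where "e1 t = \<beta> *\<^sub>R (F1 t - w t)"
definition e2 :: "real \<Rightarrow> real^3" where "e2 t = F2 t - matrix_inv J *v d t"

definition V :: "real \<Rightarrow> real" where
  "V t = stack \<beta> (F1 t - w t) (F2 t - matrix_inv J *v d t)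
          \<bullet> (Q2 *v stack \<beta> (F1 t - w t) (F2 t - matrix_inv J *v d t))"

lemma V_eq: "V t = block_vec (e1 t) (e2 t) \<bullet> (block_mat p (-1) q *v block_vec (e1 t) (e2 t))"
  by (simp add: V_def Q2_def e1_def e2_def stack_eq_block_vec)

lemma e1_has_derivative:
  assumes "t \<ge> 0"
  shows "(e1 has_vector_derivative \<beta> *\<^sub>R (e2 t - C1 *\<^sub>R e1 t)) (at t within {0..})"
proof -
  have "wd t = matrix_inv J *v (Om t + u t + d t)"
    using rigid_body_dynamics[OF assms] matrix_inv_cancel(2)[OF J_invertible, of "wd t"] by simp
  then have e1': "\<beta> *\<^sub>R (matrix_inv J *v Om t + matrix_inv J *v u t + F2 t - (C1 * \<beta>) *\<^sub>R (F1 t - w t) - wd t)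
      = \<beta> *\<^sub>R (e2 t - C1 *\<^sub>R e1 t)"
    by (simp add: e1_def e2_def matrix_vector_right_distrib algebra_simps)
  have "(e1 has_vector_derivative
      \<beta> *\<^sub>R (matrix_inv J *v Om t + matrix_inv J *v u t + F2 t - (C1 * \<beta>) *\<^sub>R (F1 t - w t) - wd t))
      (at t within {0..})"
    unfolding e1_def[abs_def]
    using F1_has_derivative[OF assms] w_has_derivative[OF assms]
    by (intro bounded_linear.has_vector_derivative[OF bounded_linear_scaleR_right]
        has_vector_derivative_diff)
  then show ?thesis by (simp only: e1')
qed

lemma e2_has_derivative:
  assumes "t \<ge> 0"
  shows "(e2 has_vector_derivative - (C2 * \<beta>) *\<^sub>R e1 t - matrix_inv J *v dd t) (at t within {0..})"
proof -
  have "((\<lambda>t. matrix_inv J *v d t) has_vector_derivative matrix_inv J *v dd t) (at t within {0..})"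
    using d_has_derivative[OF assms]
    by (rule bounded_linear.has_vector_derivative[OF matrix_vector_mul_bounded_linear])
  with F2_has_derivative[OF assms]
  have "(e2 has_vector_derivative - (C2 * \<beta>^2) *\<^sub>R (F1 t - w t) - matrix_inv J *v dd t)
      (at t within {0..})"
    unfolding e2_def[abs_def] by (rule has_vector_derivative_diff)
  then show ?thesis by (simp add: e1_def power2_eq_square algebra_simps)
qed

lemma dissipation_le_V: "- \<beta> * k1 * (e1 t \<bullet> e1 t) - \<beta> * (e2 t \<bullet> e2 t) \<le> - Cd * V t"
proof -
  have "Cd * V t \<le> Cd * ((p + q + 2) * (e1 t \<bullet> e1 t + e2 t \<bullet> e2 t))"
    unfolding V_eq using block_mat_quadratic_form_le[OF p_pos q_pos] Cd_pos by (simp add: mult_left_mono)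
  also have "\<dots> = \<beta> * min k1 1 * (e1 t \<bullet> e1 t) + \<beta> * min k1 1 * (e2 t \<bullet> e2 t)"
    unfolding Cd_def using p_pos q_pos by (simp add: field_simps)
  also have "\<dots> \<le> \<beta> * k1 * (e1 t \<bullet> e1 t) + \<beta> * (e2 t \<bullet> e2 t)"
    using beta_pos by (intro add_mono mult_right_mono mult_left_mono) auto
  finally show ?thesis by simp
qed

lemma V_has_derivative_le:
  assumes "t \<ge> 0"
  shows "\<exists>V'. (V has_real_derivative V') (at t within {0..}) \<and> V' \<le> - Cd * V t + h0"
proof -
  let ?E1 = "\<beta> *\<^sub>R (e2 t - C1 *\<^sub>R e1 t)" and ?E2 = "- (C2 * \<beta>) *\<^sub>R e1 t - matrix_inv J *v dd t"
  have V_form: "V = (\<lambda>t. p * (e1 t \<bullet> e1 t) - 2 * (e1 t \<bullet> e2 t) + q * (e2 t \<bullet> e2 t))"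
    by (simp add: fun_eq_iff V_eq block_mat_quadratic_form)
  have "(V has_real_derivative
      2 * p * (e1 t \<bullet> ?E1) - 2 * (e1 t \<bullet> ?E2 + ?E1 \<bullet> e2 t) + 2 * q * (e2 t \<bullet> ?E2)) (at t within {0..})"
    unfolding V_form
    using has_real_derivative_inner[OF e1_has_derivative e1_has_derivative, OF assms assms]
      has_real_derivative_inner[OF e1_has_derivative e2_has_derivative, OF assms assms]
      has_real_derivative_inner[OF e2_has_derivative e2_has_derivative, OF assms assms]
    by (auto intro!: derivative_eq_intros simp: inner_commute algebra_simps)
  moreover have "norm (matrix_inv J *v dd t) \<le> onorm ((*v) (matrix_inv J)) * \<bar>\<xi>d\<bar>"
  proof -
    have "norm (matrix_inv J *v dd t) \<le> onorm ((*v) (matrix_inv J)) * norm (dd t)"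
      by (rule onorm[OF matrix_vector_mul_bounded_linear])
    also have "\<dots> \<le> onorm ((*v) (matrix_inv J)) * \<bar>\<xi>d\<bar>"
      using dd_bound[OF assms] by (intro mult_left_mono onorm_pos_le) auto
    finally show ?thesis .
  qed
  then have "2 * p * (e1 t \<bullet> ?E1) - 2 * (e1 t \<bullet> ?E2 + ?E1 \<bullet> e2 t) + 2 * q * (e2 t \<bullet> ?E2)
      \<le> - \<beta> * k1 * (e1 t \<bullet> e1 t) - \<beta> * (e2 t \<bullet> e2 t)
         + (1 / (\<beta> * k1) + q^2 / \<beta>) * (onorm ((*v) (matrix_inv J)) * \<bar>\<xi>d\<bar>)^2"
    by (rule observer_lyapunov_derivative_le[OF beta_pos k1_pos k1_def q_C2 q_pos])
  ultimately show ?thesis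
    using dissipation_le_V[of t] unfolding h0_def by (intro exI conjI) auto
qed

lemma V_exp_bound:
  assumes "h \<ge> h0" "t \<ge> 0"
  shows "V t \<le> V 0 * exp (- Cd * t) + h / Cd * (1 - exp (- Cd * t))"
proof (rule differential_inequality_exp_bound[OF Cd_pos _ assms(2)])
  fix s :: real assume "s \<ge> 0"
  then show "\<exists>V'. (V has_real_derivative V') (at s within {0..}) \<and> V' \<le> - Cd * V s + h"
    using V_has_derivative_le assms(1) by force
qed

lemma disturbance_error_le:
  assumes "V t \<le> B"
  shows "norm (d t - J *v F2 t) \<le> onorm ((*v) J) * sqrt (B / (min p q / 2))"
proof -
  have "min p q / 2 * (e1 t \<bullet> e1 t) \<ge> 0" using p_pos q_pos by simp
  then have "min p q / 2 * (e2 t \<bullet> e2 t) \<le> V t"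
    using block_mat_quadratic_form_ge[OF p_pos q_pos p_q_ge_4, of "e1 t" "e2 t"]
    unfolding V_eq distrib_left by linarith
  then have "norm (e2 t) \<le> sqrt (B / (min p q / 2))"
    using assms p_pos q_pos by (simp add: norm_eq_sqrt_inner field_simps)
  have "d t - J *v F2 t = - (J *v e2 t)"
    by (simp add: e2_def matrix_vector_mult_diff_distrib matrix_inv_cancel(1)[OF J_invertible])
  then have "norm (d t - J *v F2 t) \<le> onorm ((*v) J) * norm (e2 t)"
    by (simp add: onorm[OF matrix_vector_mul_bounded_linear])
  also have "\<dots> \<le> onorm ((*v) J) * sqrt (B / (min p q / 2))"
    using \<open>norm (e2 t) \<le> _\<close> by (intro mult_left_mono onorm_pos_le) auto
  finally show ?thesis .
qed

lemma V_bounded: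
  assumes "t \<ge> 0"
  shows "V t \<le> \<bar>V 0\<bar> + hm / Cd"
proof -
  have "exp (- Cd * t) \<le> 1" "0 < exp (- Cd * t)" using Cd_pos assms by simp_all
  then have "V 0 * exp (- Cd * t) \<le> \<bar>V 0\<bar> * 1" "hm / Cd * (1 - exp (- Cd * t)) \<le> hm / Cd * 1"
    using hm_pos Cd_pos by (intro mult_mono; simp)+
  then show ?thesis using V_exp_bound[OF hm_ge_h0 assms] by linarith
qed

lemma disturbance_error_bounded: "\<exists>B. \<forall>t\<ge>0. norm (d t - J *v F2 t) \<le> B"
  using disturbance_error_le[OF V_bounded] by blast

lemma disturbance_error_ultimately_le:
  assumes "0 < \<rho>" "\<rho> < 1"
  shows "\<exists>T\<ge>0. \<forall>t\<ge>T. norm (d t - J *v F2 t) \<le> lambda_max J * sqrt (hm / (\<rho> * Cd * lambda_min Q2))"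
proof -
  obtain T where "T \<ge> 0" and T: "\<And>t. t \<ge> T \<Longrightarrow> V t \<le> h0 / (\<rho> * Cd)"
    using exp_bound_eventually_le[OF Cd_pos h0_pos assms V_exp_bound[OF order_refl]] by blast
  have "onorm ((*v) J)^2 * (h0 / (\<rho> * Cd) / (min p q / 2))
      \<le> lambda_max J^2 * (hm / (\<rho> * Cd * lambda_min Q2))"
    using divide_right_mono[OF hm_absorbs_operator_norm, of "\<rho> * Cd"] assms Cd_pos
    by (simp add: field_simps)
  then have "sqrt (onorm ((*v) J)^2) * sqrt (h0 / (\<rho> * Cd) / (min p q / 2))
      \<le> sqrt (lambda_max J^2) * sqrt (hm / (\<rho> * Cd * lambda_min Q2))"
    unfolding real_sqrt_mult[symmetric] by (rule real_sqrt_le_mono)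
  then have "onorm ((*v) J) * sqrt (h0 / (\<rho> * Cd) / (min p q / 2))
      \<le> lambda_max J * sqrt (hm / (\<rho> * Cd * lambda_min Q2))"
    using onorm_pos_le[OF matrix_vector_mul_bounded_linear, of J] lambda_max_3_pos[OF J_spd] by simp
  then show ?thesis using \<open>T \<ge> 0\<close> T disturbance_error_le order_trans by blast
qed

end

theorem mainTheorem2:
  fixes J :: "real^3^3" and C1 C2 \<beta> \<xi>d :: real
  assumes J: "sym_pos_def J"
    and C1: "C1 > 0" and C2: "C2 > 0" and beta: "\<beta> > 0"
  shows "\<exists>(Q2 :: real^(3+3)^(3+3)) Cd hm. sym_pos_def Q2 \<and> Cd > 0 \<and> hm \<ge> 0 \<and>
    (\<forall>(qv :: real \<Rightarrow> real^3) (q0 :: real \<Rightarrow> real) (w :: real \<Rightarrow> real^3) (wd :: real \<Rightarrow> real^3)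
       (Om :: real \<Rightarrow> real^3) (u :: real \<Rightarrow> real^3) (d :: real \<Rightarrow> real^3) (dd :: real \<Rightarrow> real^3)
       (F1 :: real \<Rightarrow> real^3) (F2 :: real \<Rightarrow> real^3).
      (\<forall>t\<ge>0. norm (qv t) ^ 2 + (q0 t) ^ 2 = 1) \<longrightarrow>
      (\<forall>t\<ge>0. (qv has_vector_derivative (Fe (qv t) (q0 t) *v w t)) (at t within {0..})) \<longrightarrow>
      (\<forall>t\<ge>0. (q0 has_real_derivative (- (1/2) * (qv t \<bullet> w t))) (at t within {0..})) \<longrightarrow>
      (\<forall>t\<ge>0. (w has_vector_derivative wd t) (at t within {0..}) \<and>
               J *v wd t = Om t + u t + d t) \<longrightarrow>
      (\<exists>D. \<forall>t\<ge>0. norm (d t) \<le> D) \<longrightarrow>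
      (\<forall>t\<ge>0. (d has_vector_derivative dd t) (at t within {0..}) \<and> norm (dd t) \<le> \<xi>d) \<longrightarrow>
      (\<forall>t\<ge>0. (F1 has_vector_derivative
                 (matrix_inv J *v Om t + matrix_inv J *v u t + F2 t
                   - (C1 * \<beta>) *\<^sub>R (F1 t - w t))) (at t within {0..})) \<longrightarrow>
      (\<forall>t\<ge>0. (F2 has_vector_derivative
                 (- (C2 * \<beta>^2) *\<^sub>R (F1 t - w t))) (at t within {0..})) \<longrightarrow>
      (let eps = (\<lambda>t. stack \<beta> (F1 t - w t) (F2 t - matrix_inv J *v d t));
           V = (\<lambda>t. eps t \<bullet> (Q2 *v eps t));
           dtil = (\<lambda>t. d t - J *v F2 t)
       in (\<forall>t\<ge>0. \<exists>V'. (V has_real_derivative V') (at t within {0..}) \<and> V' \<le> - Cd * V t + hm)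
        \<and> (\<forall>t\<ge>0. V t \<le> V 0 * exp (- Cd * t) + hm / Cd * (1 - exp (- Cd * t)))
        \<and> (\<forall>c. 0 < c \<and> c < 1 \<longrightarrow> (\<exists>T\<ge>0. \<forall>t\<ge>T. V t \<le> hm / (c * Cd)))
        \<and> (\<exists>B. \<forall>t\<ge>0. norm (dtil t) \<le> B)
        \<and> (\<forall>c. 0 < c \<and> c < 1 \<longrightarrow> (\<exists>T\<ge>0. \<forall>t\<ge>T.
              norm (dtil t) \<le> lambda_max J * sqrt (hm / (c * Cd * lambda_min Q2))))))"
proof -
  interpret disturbance_observer J C1 C2 \<beta> \<xi>d
    using J C1 C2 beta by unfold_locales
  show ?thesis
  proof (rule exI[of _ Q2], rule exI[of _ Cd], rule exI[of _ hm], intro conjI allI impI, goal_cases)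
    case 1 show ?case by (rule Q2_spd)
    case 2 show ?case by (rule Cd_pos)
    case 3 show ?case using hm_pos by simp
  next
    case (4 qv q0 w wd Om u d dd F1 F2)
    text \<open>Neither the attitude kinematics nor the bound on \<open>d\<close> enter the observer error dynamics.\<close>
    interpret disturbance_observer_trajectory J C1 C2 \<beta> \<xi>d w wd Om u d dd F1 F2
      using "4"(4,6,7,8) by unfold_locales auto
    have "\<forall>t\<ge>0. \<exists>V'. (V has_real_derivative V') (at t within {0..}) \<and> V' \<le> - Cd * V t + hm"
      using V_has_derivative_le hm_ge_h0 by force
    moreover have "\<forall>c. 0 < c \<and> c < 1 \<longrightarrow> (\<exists>T\<ge>0. \<forall>t\<ge>T. V t \<le> hm / (c * Cd))"
      using exp_bound_eventually_le[OF Cd_pos hm_pos _ _ V_exp_bound[OF hm_ge_h0]] by blast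
    moreover have "\<forall>t\<ge>0. V t \<le> V 0 * exp (- Cd * t) + hm / Cd * (1 - exp (- Cd * t))"
      using V_exp_bound[OF hm_ge_h0] by blast
    moreover have "\<forall>c. 0 < c \<and> c < 1 \<longrightarrow> (\<exists>T\<ge>0. \<forall>t\<ge>T.
        norm (d t - J *v F2 t) \<le> lambda_max J * sqrt (hm / (c * Cd * lambda_min Q2)))"
      using disturbance_error_ultimately_le by blast
    ultimately show ?case
      unfolding Let_def V_def[abs_def, symmetric] V_def[symmetric]
      using disturbance_error_bounded by (intro conjI)
  qed
qed

end
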